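(* Each $\mathfrak{P}$-space is a strict $\aleph$-space, and each strict $\aleph$-space is an $\aleph$-space.
   Context: All topological spaces are Hausdorff. Let $\mathcal N$ be a family of subsets of a space $X$. $\mathcal N$ is a $k$-network in $X$ if whenever $K\subset U$ with $K$ compact and $U$ open in $X$, then $K\subset\bigcup\mathcal F\subset U$ for some finite $\mathcal F\subset\mathcal N$. $\mathcal N$ is a $ck$-network at $x\in X$ if for any neighborhood $O_x$ of $x$ there is a neighborhood $U_x$ of $x$ such that for each compact $K\subset U_x$ there is a finite $\mathcal F\subset\mathcal N$ with $x\in\bigcap\mathcal F$ and $K\subset\bigcup\mathcal F\subset O_x$. $\mathcal N$ is a $cp$-network at $x$ if either $x$ is isolated in $X$ and $\{x\}\in\mathcal N$, or for each $A\subset X$ with $x\in\overline A\setminus A$ and each neighborhood $O_x$ of $x$ there is $N\in\mathcal N$ with $x\in N\subset O_x$ and $N\cap A$ infinite. $\mathcal N$ is a $ck$-network (resp. $cp$-network) in $X$ if it is one at each point of $X$. A family is $\sigma$-locally finite if it is a countable union of locally finite families. A regular space is a $\mathfrak{P}$-space, a strict $\aleph$-space, or an $\aleph$-space if it has a $\sigma$-locally finite $cp$-network, $ck$-network, or $k$-network, respectively.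
   Formalization: In the definition of cp-network, the second alternative is required only at non-isolated x, so {x} ∈ 𝒩 is demanded at every isolated x; read literally, the second alternative holds vacuously at isolated points and the Michael line would refute the first claim. *)

theory Defs
  imports "HOL-Analysis.Analysis"
begin

text \<open>
  Spaces are abstract topologies.  A neighbourhood of a point need not be open.
\<close>

definition neighbourhood_at :: "'a topology \<Rightarrow> 'a \<Rightarrow> 'a set \<Rightarrow> bool" where
  "neighbourhood_at X x U \<longleftrightarrow> U \<subseteq> topspace X \<and> x \<in> X interior_of U"

definition k_network :: "'a topology \<Rightarrow> 'a set set \<Rightarrow> bool" where
  "k_network X \<N> \<longleftrightarrow> \<N> \<subseteq> Pow (topspace X) \<and>
     (\<forall>K U. compactin X K \<longrightarrow> openin X U \<longrightarrow> K \<subseteq> U \<longrightarrow>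
       (\<exists>\<F>. finite \<F> \<and> \<F> \<subseteq> \<N> \<and> K \<subseteq> \<Union>\<F> \<and> \<Union>\<F> \<subseteq> U))"

text \<open>
  In the next definition \<open>\<F>\<close> may be empty only if \<open>K\<close> is empty, as \<open>\<Inter>{} = UNIV\<close>; forbidding this
  would change nothing, since the family obtained for \<open>{x}\<close> also serves for the empty compact set.
\<close>

definition ck_network_at :: "'a topology \<Rightarrow> 'a set set \<Rightarrow> 'a \<Rightarrow> bool" where
  "ck_network_at X \<N> x \<longleftrightarrow>
     (\<forall>Ox. neighbourhood_at X x Ox \<longrightarrow>
       (\<exists>Ux. neighbourhood_at X x Ux \<and>
         (\<forall>K. compactin X K \<longrightarrow> K \<subseteq> Ux \<longrightarrow>
           (\<exists>\<F>. finite \<F> \<and> \<F> \<subseteq> \<N> \<and> x \<in> \<Inter>\<F> \<and> K \<subseteq> \<Union>\<F> \<and> \<Union>\<F> \<subseteq> Ox))))"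

definition ck_network :: "'a topology \<Rightarrow> 'a set set \<Rightarrow> bool" where
  "ck_network X \<N> \<longleftrightarrow> \<N> \<subseteq> Pow (topspace X) \<and> (\<forall>x\<in>topspace X. ck_network_at X \<N> x)"

text \<open>
  The second alternative of a \<open>cp\<close>-network is meant for non-isolated points.  At an isolated
  point no \<open>A\<close> satisfies \<open>x \<in> X closure_of A - A\<close>, so without the explicit guard the second
  alternative would hold vacuously there and the requirement \<open>{x} \<in> \<N>\<close> would be void.
\<close>

definition cp_network_at :: "'a topology \<Rightarrow> 'a set set \<Rightarrow> 'a \<Rightarrow> bool" where
  "cp_network_at X \<N> x \<longleftrightarrow>
     (openin X {x} \<and> {x} \<in> \<N>) \<or>
     (\<not> openin X {x} \<and>
       (\<forall>A Ox. A \<subseteq> topspace X \<longrightarrow> x \<in> X closure_of A - A \<longrightarrow> neighbourhood_at X x Ox \<longrightarrow>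
         (\<exists>N\<in>\<N>. x \<in> N \<and> N \<subseteq> Ox \<and> infinite (N \<inter> A))))"

definition cp_network :: "'a topology \<Rightarrow> 'a set set \<Rightarrow> bool" where
  "cp_network X \<N> \<longleftrightarrow> \<N> \<subseteq> Pow (topspace X) \<and> (\<forall>x\<in>topspace X. cp_network_at X \<N> x)"

definition sigma_locally_finite_in :: "'a topology \<Rightarrow> 'a set set \<Rightarrow> bool" where
  "sigma_locally_finite_in X \<N> \<longleftrightarrow>
     (\<exists>\<M> :: nat \<Rightarrow> 'a set set. \<N> = (\<Union>n. \<M> n) \<and> (\<forall>n. locally_finite_in X (\<M> n)))"

text \<open>
  The library's \<^const>\<open>regular_space\<close> does not include a separation axiom for points; the
  Hausdorff property is a standing assumption on all spaces and is stated separately.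
\<close>

definition P_space :: "'a topology \<Rightarrow> bool" where
  "P_space X \<longleftrightarrow> regular_space X \<and> (\<exists>\<N>. sigma_locally_finite_in X \<N> \<and> cp_network X \<N>)"

definition strict_aleph_space :: "'a topology \<Rightarrow> bool" where
  "strict_aleph_space X \<longleftrightarrow>
     regular_space X \<and> (\<exists>\<N>. sigma_locally_finite_in X \<N> \<and> ck_network X \<N>)"

definition aleph_space :: "'a topology \<Rightarrow> bool" where
  "aleph_space X \<longleftrightarrow> regular_space X \<and> (\<exists>\<N>. sigma_locally_finite_in X \<N> \<and> k_network X \<N>)"

end

theory Submission
  imports Defs
begin

text \<open>
  Any \<open>ck\<close>-network in a regular space is a \<open>k\<close>-network: cover a compact set by finitely many of its
  compact pieces, each small enough for the \<open>ck\<close>-property at one of its points.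

  Conversely, let the members of a \<open>cp\<close>-network at \<open>x\<close> that contain \<open>x\<close> and lie in \<open>O\<^sub>x\<close> be
  \<open>N\<^sub>0, N\<^sub>1, \<dots>\<close> and put \<open>W\<^sub>n = N\<^sub>0 \<union> \<dots> \<union> N\<^sub>n\<close>.  Call \<open>z\<close> bad if it is a cluster point of a sequence
  \<open>y\<^sub>0, y\<^sub>1, \<dots>\<close> with \<open>y\<^sub>j \<notin> W\<^sub>j\<close>.  A compact set that is covered by no \<open>W\<^sub>n\<close> contains a bad point, so
  it suffices that \<open>x\<close> is not in the closure of the bad points.  If it were, countable tightness would
  yield bad points \<open>z\<^sub>0, z\<^sub>1, \<dots>\<close> clustering at \<open>x\<close>, with sequences \<open>y\<^sub>k\<^sub>j\<close>; the set of all
  \<open>y\<^sub>k\<^sub>j\<close> with \<open>j \<ge> k\<close> then has \<open>x\<close> in its closure, but meets each \<open>W\<^sub>n\<close> in a finite set, against the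
  \<open>cp\<close>-property.
\<close>

lemma neighbourhood_at_iff_openin:
  "neighbourhood_at X x U \<longleftrightarrow> U \<subseteq> topspace X \<and> (\<exists>V. openin X V \<and> x \<in> V \<and> V \<subseteq> U)"
  by (auto simp: neighbourhood_at_def interior_of_def)

lemma neighbourhood_at_openin: "openin X U \<Longrightarrow> x \<in> U \<Longrightarrow> neighbourhood_at X x U"
  by (auto simp: neighbourhood_at_iff_openin dest: openin_subset)

lemma ck_network_atE:
  assumes "ck_network_at X \<N> x" "neighbourhood_at X x Ox"
  obtains Ux where "neighbourhood_at X x Ux"
    "\<And>K. compactin X K \<Longrightarrow> K \<subseteq> Ux \<Longrightarrow>
       \<exists>\<F>. finite \<F> \<and> \<F> \<subseteq> \<N> \<and> x \<in> \<Inter>\<F> \<and> K \<subseteq> \<Union>\<F> \<and> \<Union>\<F> \<subseteq> Ox"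
  using assms(1)[unfolded ck_network_at_def, THEN spec, THEN mp, OF assms(2)]
  by (elim exE conjE) (rule that, assumption, iprover)

lemma ck_network_imp_k_network:
  assumes reg: "regular_space X" and ck: "ck_network X \<N>"
  shows "k_network X \<N>"
  unfolding k_network_def
proof (intro conjI allI impI)
  show "\<N> \<subseteq> Pow (topspace X)"
    using ck by (simp add: ck_network_def)
next
  fix K U assume K: "compactin X K" and U: "openin X U" "K \<subseteq> U"
  have local_cover: "\<exists>V \<F>. openin X V \<and> x \<in> V \<and> finite \<F> \<and> \<F> \<subseteq> \<N> \<and> K \<inter> V \<subseteq> \<Union>\<F> \<and> \<Union>\<F> \<subseteq> U"
    if x: "x \<in> K" for x
  proof -
    have "x \<in> topspace X"
      using x K compactin_subset_topspace by fastforce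
    then have "ck_network_at X \<N> x"
      using ck by (simp add: ck_network_def)
    moreover have "neighbourhood_at X x U"
      using U x by (auto intro: neighbourhood_at_openin)
    ultimately obtain Ux where Ux: "neighbourhood_at X x Ux"
      and cover: "\<And>L. compactin X L \<Longrightarrow> L \<subseteq> Ux \<Longrightarrow>
             \<exists>\<F>. finite \<F> \<and> \<F> \<subseteq> \<N> \<and> x \<in> \<Inter>\<F> \<and> L \<subseteq> \<Union>\<F> \<and> \<Union>\<F> \<subseteq> U"
      by (rule ck_network_atE) (rule that, assumption, iprover)
    obtain G where G: "openin X G" "x \<in> G" "G \<subseteq> Ux"
      using Ux by (auto simp: neighbourhood_at_iff_openin)
    \<comment> \<open>\<open>K \<inter> V\<close> need not be compact. Regularity puts a closed
      \<open>C\<close> between \<open>V\<close> and \<open>G\<close>, and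
      \<open>C \<inter> K\<close> is compact.\<close>
    have "\<exists>V C. openin X V \<and> closedin X C \<and> x \<in> V \<and> V \<subseteq> C \<and> C \<subseteq> G"
      using reg G(1,2) unfolding neighbourhood_base_of_closedin[symmetric] neighbourhood_base_of by simp
    then obtain V C where V: "openin X V" "closedin X C" "x \<in> V" "V \<subseteq> C" "C \<subseteq> Ux"
      using G(3) by (metis subset_trans)
    have "compactin X (C \<inter> K)"
      using V K closed_Int_compactin by blast
    moreover have "C \<inter> K \<subseteq> Ux"
      using V by blast
    ultimately obtain \<F> where \<F>: "finite \<F>" "\<F> \<subseteq> \<N>" "C \<inter> K \<subseteq> \<Union>\<F>" "\<Union>\<F> \<subseteq> U"
      using cover by metis
    have "K \<inter> V \<subseteq> \<Union>\<F>"
      using V \<F> by blast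
    then show ?thesis
      using V \<F> by metis
  qed
  then obtain V \<F> where V: "\<And>x. x \<in> K \<Longrightarrow> openin X (V x) \<and> x \<in> V x"
    and \<F>: "\<And>x. x \<in> K \<Longrightarrow> finite (\<F> x) \<and> \<F> x \<subseteq> \<N> \<and> K \<inter> V x \<subseteq> \<Union>(\<F> x) \<and> \<Union>(\<F> x) \<subseteq> U"
    by metis
  have "K \<subseteq> \<Union>(V ` K)" "\<And>T. T \<in> V ` K \<Longrightarrow> openin X T"
    using V by auto
  then obtain \<T> where \<T>: "finite \<T>" "\<T> \<subseteq> V ` K" "K \<subseteq> \<Union>\<T>"
    using compactinD[OF K] by metis
  then obtain I where I: "I \<subseteq> K" "finite I" "\<T> = V ` I"
    by (meson finite_subset_image)
  show "\<exists>\<F>. finite \<F> \<and> \<F> \<subseteq> \<N> \<and> K \<subseteq> \<Union>\<F> \<and> \<Union>\<F> \<subseteq> U"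
  proof (intro exI conjI)
    show "finite (\<Union>(\<F> ` I))"
      using I \<F> by auto
    show "\<Union>(\<F> ` I) \<subseteq> \<N>" "\<Union>(\<Union>(\<F> ` I)) \<subseteq> U"
      using I \<F> by blast+
    show "K \<subseteq> \<Union>(\<Union>(\<F> ` I))"
    proof
      fix y assume "y \<in> K"
      then obtain i where "i \<in> I" "y \<in> V i"
        using \<T> I by auto
      then show "y \<in> \<Union>(\<Union>(\<F> ` I))"
        using \<F>[of i] I \<open>y \<in> K\<close> by blast
    qed
  qed
qed

text \<open>A neighbourhood of \<open>x\<close> that meets only finitely many members of one layer
  \<open>\<M> n\<close> meets all of its members through \<open>x\<close>. The passage from
  \<open>cp\<close> to \<open>ck\<close> draws only this countability from sigma-local
  finiteness.\<close>

lemma sigma_locally_finite_in_imp_point_countable: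
  assumes "sigma_locally_finite_in X \<N>" "x \<in> topspace X"
  shows "countable {N \<in> \<N>. x \<in> N}"
proof -
  obtain \<M> :: "nat \<Rightarrow> _" where \<M>: "\<N> = (\<Union>n. \<M> n)" "\<And>n. locally_finite_in X (\<M> n)"
    using assms(1) unfolding sigma_locally_finite_in_def by blast
  have "finite {N \<in> \<M> n. x \<in> N}" for n
  proof -
    obtain V where "x \<in> V" "finite {N \<in> \<M> n. N \<inter> V \<noteq> {}}"
      using \<M>(2)[of n] assms(2) unfolding locally_finite_in_def by blast
    then show ?thesis
      by (auto elim: rev_finite_subset)
  qed
  then have "countable (\<Union>n. {N \<in> \<M> n. x \<in> N})"
    by (simp add: countable_finite)
  moreover have "{N \<in> \<N>. x \<in> N} = (\<Union>n. {N \<in> \<M> n. x \<in> N})"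
    using \<M>(1) by auto
  ultimately show ?thesis by simp
qed

text \<open>The complements of the closures of the tails are open and increasing, so a finite
  subcover of \<open>K\<close> would reduce to a single \<open>G m\<close>, which misses
  \<open>y m\<close>. Clustering is phrased through tails since no subsequence need
  converge.\<close>

lemma compactin_sequence_cluster_point:
  fixes y :: "nat \<Rightarrow> 'a"
  assumes K: "compactin X K" and y: "\<And>j. y j \<in> K"
  obtains z where "z \<in> K" "\<And>m. z \<in> X closure_of (y ` {m..})"
proof -
  define G where "G m = topspace X - X closure_of (y ` {m..})" for m
  have sub: "K \<subseteq> topspace X"
    using K by (rule compactin_subset_topspace)
  have G_mono: "G m \<subseteq> G n" if "m \<le> n" for m n
  proof -
    have "X closure_of (y ` {n..}) \<subseteq> X closure_of (y ` {m..})"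
      using that by (intro closure_of_mono image_mono) auto
    then show ?thesis
      by (auto simp: G_def)
  qed
  have "\<not> K \<subseteq> (\<Union>m. G m)"
  proof
    assume "K \<subseteq> (\<Union>m. G m)"
    moreover have "\<And>T. T \<in> range G \<Longrightarrow> openin X T"
      by (auto simp: G_def openin_diff)
    ultimately obtain \<T> where "finite \<T>" "\<T> \<subseteq> range G" "K \<subseteq> \<Union>\<T>"
      using compactinD[OF K] by metis
    then obtain I where I: "finite I" "K \<subseteq> \<Union>(G ` I)"
      by (metis finite_subset_image)
    have I_le: "i \<le> Max I" if "i \<in> I" for i
      using I(1) that by (rule Max_ge)
    \<comment> \<open>If \<open>I\<close> is empty, \<open>Max I\<close> is unspecified, but the
      union over \<open>I\<close> is then empty and any \<open>m\<close> serves.\<close>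
    define m where "m = Max I"
    have "\<Union>(G ` I) \<subseteq> G m"
      unfolding m_def by (intro UN_least G_mono I_le)
    then have "K \<subseteq> G m"
      using I(2) by (rule subset_trans[rotated])
    moreover have "y m \<in> X closure_of (y ` {m..})"
      using y sub closure_of_subset[of "y ` {m..}" X] by (auto simp: image_subset_iff)
    ultimately show False
      using y[of m] by (auto simp: G_def)
  qed
  then show ?thesis
    using that sub by (auto simp: G_def)
qed

text \<open>Choose one point of \<open>A\<close> from each of the countably many members through
  \<open>x\<close> that meet \<open>A\<close>. Were \<open>x\<close> outside the closure of these
  points, the complement of that closure would contain such a member together with its chosen
  point.\<close>

lemma cp_network_at_countably_tight:
  assumes cp: "cp_network_at X \<N> x" and cnt: "countable {N \<in> \<N>. x \<in> N}"
    and A: "A \<subseteq> topspace X" "x \<in> X closure_of A"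
  obtains C where "countable C" "C \<subseteq> A" "x \<in> X closure_of C"
proof (cases "x \<in> A")
  case True
  have "x \<in> X closure_of {x}"
    using A(1) True closure_of_subset[of "{x}" X] by auto
  then show ?thesis
    using that[of "{x}"] True by auto
next
  case False
  have "\<not> openin X {x}"
    using A False unfolding in_closure_of by blast
  then have cpD: "\<And>B Ox. B \<subseteq> topspace X \<Longrightarrow> x \<in> X closure_of B - B \<Longrightarrow> neighbourhood_at X x Ox \<Longrightarrow>
      \<exists>N\<in>\<N>. x \<in> N \<and> N \<subseteq> Ox \<and> infinite (N \<inter> B)"
    using cp unfolding cp_network_at_def by blast
  define c where "c N = (SOME a. a \<in> N \<inter> A)" for N
  define C where "C = c ` {N \<in> \<N>. x \<in> N \<and> N \<inter> A \<noteq> {}}"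
  have c: "c N \<in> N \<inter> A" if "N \<inter> A \<noteq> {}" for N
    using that unfolding c_def by (metis all_not_in_conv someI_ex)
  have "countable {N \<in> \<N>. x \<in> N \<and> N \<inter> A \<noteq> {}}"
    by (rule countable_subset[OF _ cnt]) auto
  then have "countable C"
    unfolding C_def by (rule countable_image)
  moreover have "C \<subseteq> A"
    using c by (auto simp: C_def)
  moreover have "x \<in> X closure_of C"
  proof (rule ccontr)
    assume notin: "x \<notin> X closure_of C"
    define G where "G = topspace X - X closure_of C"
    have "x \<in> topspace X"
      using A(2) by (meson in_closure_of)
    then have "neighbourhood_at X x G"
      using notin by (intro neighbourhood_at_openin) (auto simp: G_def openin_diff)
    then obtain N where N: "N \<in> \<N>" "x \<in> N" "N \<subseteq> G" "infinite (N \<inter> A)"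
      using cpD[of A G] A False by blast
    then have "N \<inter> A \<noteq> {}"
      by auto
    then have "c N \<in> C" "c N \<in> G"
      using N c[of N] by (auto simp: C_def)
    moreover have "C \<subseteq> X closure_of C"
      using \<open>C \<subseteq> A\<close> A(1) by (intro closure_of_subset) auto
    ultimately show False
      by (auto simp: G_def)
  qed
  ultimately show ?thesis
    using that by blast
qed

lemma non_isolated_imp_in_closure_of:
  assumes "\<not> openin X {x}" "x \<in> topspace X"
  shows "x \<in> X closure_of (topspace X - {x})"
  unfolding in_closure_of
proof (intro conjI allI impI)
  fix T assume T: "x \<in> T \<and> openin X T"
  then have "T \<subseteq> topspace X" "T \<noteq> {x}"
    using assms(1) openin_subset by auto
  then show "\<exists>y. y \<in> topspace X - {x} \<and> y \<in> T"
    using T by blast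
qed (rule assms(2))

lemma cp_network_at_imp_ck_network_at:
  assumes cp: "cp_network_at X \<N> x" and cnt: "countable {N \<in> \<N>. x \<in> N}"
    and x: "x \<in> topspace X"
  shows "ck_network_at X \<N> x"
proof (cases "openin X {x}")
  case True
  then have "{x} \<in> \<N>"
    using cp by (auto simp: cp_network_at_def)
  \<comment> \<open>Here \<open>Ux = {x}\<close> works: the single member \<open>{x}\<close> covers
    each of its compact subsets.\<close>
  show ?thesis
    unfolding ck_network_at_def
  proof (intro allI impI)
    fix Ox assume "neighbourhood_at X x Ox"
    then have "x \<in> Ox"
      by (auto simp: neighbourhood_at_iff_openin)
    with \<open>{x} \<in> \<N>\<close> show "\<exists>Ux. neighbourhood_at X x Ux \<and> (\<forall>K. compactin X K \<longrightarrow> K \<subseteq> Ux \<longrightarrow>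
           (\<exists>\<F>. finite \<F> \<and> \<F> \<subseteq> \<N> \<and> x \<in> \<Inter>\<F> \<and> K \<subseteq> \<Union>\<F> \<and> \<Union>\<F> \<subseteq> Ox))"
      using neighbourhood_at_openin[OF True]
      by (intro exI[of _ "{x}"] conjI allI impI) (auto intro!: exI[of _ "{{x}}"])
  qed
next
  case False
  then have cpD: "\<And>B Ox. B \<subseteq> topspace X \<Longrightarrow> x \<in> X closure_of B - B \<Longrightarrow> neighbourhood_at X x Ox \<Longrightarrow>
      \<exists>N\<in>\<N>. x \<in> N \<and> N \<subseteq> Ox \<and> infinite (N \<inter> B)"
    using cp unfolding cp_network_at_def by blast
  show ?thesis
    unfolding ck_network_at_def
  proof (intro allI impI)
    fix Ox assume Ox: "neighbourhood_at X x Ox"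
    define \<P> where "\<P> = {N \<in> \<N>. x \<in> N \<and> N \<subseteq> Ox}"
    have "countable \<P>"
      unfolding \<P>_def by (rule countable_subset[OF _ cnt]) auto
    \<comment> \<open>A non-isolated \<open>x\<close> lies in the closure of its complement, so the
      \<open>cp\<close>-property yields a member of \<open>\<P>\<close>. Being nonempty,
      \<open>\<P>\<close> can be enumerated as a range, possibly with repetitions.\<close>
    moreover have "\<P> \<noteq> {}"
      using cpD[of "topspace X - {x}" Ox] Ox non_isolated_imp_in_closure_of[OF False x]
      by (auto simp: \<P>_def)
    ultimately obtain f :: "nat \<Rightarrow> _" where f: "\<P> = range f"
      by (metis uncountable_def)
    define W where "W n = (\<Union>i\<le>n. f i)" for n
    have f_in: "f i \<in> \<N>" "x \<in> f i" "f i \<subseteq> Ox" for i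
      using f by (auto simp: \<P>_def)
    have x_W: "x \<in> W n" for n
      using f_in by (auto simp: W_def)
    have no_finite_traces: False
      if A: "A \<subseteq> topspace X" "x \<in> X closure_of A - A" "\<And>n. finite (W n \<inter> A)" for A
    proof -
      obtain N where N: "N \<in> \<P>" "infinite (N \<inter> A)"
        using cpD[OF A(1,2) Ox] by (auto simp: \<P>_def)
      then obtain n where "N = f n"
        using f by auto
      then have "N \<inter> A \<subseteq> W n \<inter> A"
        by (auto simp: W_def)
      then show False
        using N A(3) finite_subset by blast
    qed
    \<comment> \<open>As \<open>W\<close> increases, \<open>y j \<notin> W j\<close> keeps
      \<open>y j\<close> out of \<open>W n\<close> for all \<open>n \<le> j\<close>. Requiring
      \<open>z\<close> in the closure of every tail allows initial terms to be dropped
      later.\<close>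
    define bad where "bad z y \<longleftrightarrow> range y \<subseteq> topspace X \<and> (\<forall>j. y j \<notin> W j) \<and>
                        (\<forall>m. z \<in> X closure_of (y ` {m..}))" for z and y :: "nat \<Rightarrow> 'a"
    define B where "B = {z. \<exists>y. bad z y}"
    have B_sub: "B \<subseteq> topspace X"
      by (auto simp: B_def bad_def in_closure_of)
    have x_notin: "x \<notin> X closure_of B"
    proof
      assume "x \<in> X closure_of B"
      then obtain C where C: "countable C" "C \<subseteq> B" "x \<in> X closure_of C"
        using cp_network_at_countably_tight[OF cp cnt B_sub] by blast
      moreover have "C \<noteq> {}"
        using C(3) by auto
      ultimately obtain z :: "nat \<Rightarrow> _" where z: "C = range z"
        by (metis uncountable_def)
      have "\<forall>k. \<exists>y. bad (z k) y"
        using C(2) z by (auto simp: B_def)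
      then obtain y where y: "\<And>k. bad (z k) (y k)"
        by (rule choice[THEN exE]) auto
      \<comment> \<open>Dropping the first \<open>k\<close> terms of the \<open>k\<close>-th
        sequence keeps \<open>z k\<close> in the closure, and \<open>y k j \<in> W n\<close> now
        forces \<open>k \<le> j < n\<close>, which leaves finitely many pairs.\<close>
      define A where "A = (\<Union>k. y k ` {k..})"
      have A_sub: "A \<subseteq> topspace X"
        using y by (force simp: A_def bad_def)
      have "z k \<in> X closure_of A" for k
      proof -
        have "z k \<in> X closure_of (y k ` {k..})"
          using y by (simp add: bad_def)
        moreover have "X closure_of (y k ` {k..}) \<subseteq> X closure_of A"
          by (rule closure_of_mono) (auto simp: A_def)
        ultimately show ?thesis by blast
      qed
      then have "X closure_of C \<subseteq> X closure_of A"
        unfolding z by (intro closure_of_minimal) auto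
      \<comment> \<open>Every \<open>W j\<close> contains \<open>x\<close>, whereas
        \<open>y k j\<close> avoids \<open>W j\<close>.\<close>
      moreover have "x \<notin> A"
        using y x_W by (fastforce simp: A_def bad_def)
      moreover have "finite (W n \<inter> A)" for n
      proof -
        have "W n \<inter> A \<subseteq> (\<lambda>(k, j). y k j) ` ({..<n} \<times> {..<n})"
        proof
          fix a assume a: "a \<in> W n \<inter> A"
          then obtain k j where kj: "a = y k j" "k \<le> j"
            by (auto simp: A_def)
          have "j < n"
          proof (rule ccontr)
            assume "\<not> j < n"
            then have "W n \<subseteq> W j"
              by (fastforce simp: W_def)
            then show False
              using a kj y[of k] by (auto simp: bad_def)
          qed
          then show "a \<in> (\<lambda>(k, j). y k j) ` ({..<n} \<times> {..<n})"
            using kj by force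
        qed
        then show ?thesis
          by (rule finite_subset) auto
      qed
      ultimately show False
        using no_finite_traces[OF A_sub] C(3) by blast
    qed
    show "\<exists>Ux. neighbourhood_at X x Ux \<and> (\<forall>K. compactin X K \<longrightarrow> K \<subseteq> Ux \<longrightarrow>
           (\<exists>\<F>. finite \<F> \<and> \<F> \<subseteq> \<N> \<and> x \<in> \<Inter>\<F> \<and> K \<subseteq> \<Union>\<F> \<and> \<Union>\<F> \<subseteq> Ox))"
    \<comment> \<open>A compact \<open>K\<close> in this open set contains no bad point, so some
      \<open>W n\<close> must cover it.\<close>
    proof (rule exI[of _ "topspace X - X closure_of B"], intro conjI allI impI)
      show "neighbourhood_at X x (topspace X - X closure_of B)"
        using x x_notin by (intro neighbourhood_at_openin) (auto simp: openin_diff)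
      fix K assume K: "compactin X K" "K \<subseteq> topspace X - X closure_of B"
      have "\<exists>n. K \<subseteq> W n"
      proof (rule ccontr)
        assume "\<not> (\<exists>n. K \<subseteq> W n)"
        then have "\<forall>n. \<exists>a. a \<in> K \<and> a \<notin> W n"
          by blast
        then obtain y where y: "\<And>n. y n \<in> K" "\<And>n. y n \<notin> W n"
          by metis
        then obtain z where z: "z \<in> K" "\<And>m. z \<in> X closure_of (y ` {m..})"
          using compactin_sequence_cluster_point[OF K(1)] by blast
        then have "bad z y"
          using y K(2) by (auto simp: bad_def)
        then have "z \<in> B"
          by (auto simp: B_def)
        then show False
          using z K(2) closure_of_subset[OF B_sub] by blast
      qed
      then obtain n where n: "K \<subseteq> W n" ..
      have "finite (f ` {..n})" "f ` {..n} \<subseteq> \<N>" "x \<in> \<Inter>(f ` {..n})"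
        "K \<subseteq> \<Union>(f ` {..n})" "\<Union>(f ` {..n}) \<subseteq> Ox"
        using n f_in by (auto simp: W_def dest: subsetD[OF f_in(3)])
      then show "\<exists>\<F>. finite \<F> \<and> \<F> \<subseteq> \<N> \<and> x \<in> \<Inter>\<F> \<and> K \<subseteq> \<Union>\<F> \<and> \<Union>\<F> \<subseteq> Ox"
        by iprover
    qed
  qed
qed

theorem proposition3p11:
  fixes X :: "'a topology"
  assumes "Hausdorff_space X"
  shows "(P_space X \<longrightarrow> strict_aleph_space X) \<and> (strict_aleph_space X \<longrightarrow> aleph_space X)"
proof (intro conjI impI)
  assume "P_space X"
  then obtain \<N> where "regular_space X" and \<N>: "sigma_locally_finite_in X \<N>" "cp_network X \<N>"
    by (auto simp: P_space_def)
  \<comment> \<open>The same family serves, so its sigma-local finiteness carries over.\<close>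
  moreover have "ck_network X \<N>"
    using \<N> cp_network_at_imp_ck_network_at sigma_locally_finite_in_imp_point_countable
    unfolding ck_network_def cp_network_def by metis
  ultimately show "strict_aleph_space X"
    by (auto simp: strict_aleph_space_def)
next
  assume "strict_aleph_space X"
  then show "aleph_space X"
    using ck_network_imp_k_network by (auto simp: strict_aleph_space_def aleph_space_def)
qed

end
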